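(* Let $(X,d)$ be a nonempty metric space and let $U$ be a subset of $F_{USCG}(X)$. Then the following are equivalent: (i) $U$ is compact in $(F_{USCG}(X), H_{\rm end})$; (ii) $U(\alpha)$ is relatively compact in $(X,d)$ for each $\alpha\in(0,1]$ and $U$ is closed in $(F_{USCG}(X), H_{\rm end})$; (iii) $U(\alpha)$ is compact in $(X,d)$ for each $\alpha\in(0,1]$ and $U$ is closed in $(F_{USCG}(X), H_{\rm end})$.
   Context: A fuzzy set in $X$ is a function $u:X\to[0,1]$. For $\alpha\in(0,1]$, $[u]_\alpha=\{x\in X: u(x)\ge\alpha\}$, and $[u]_0=\overline{\{x\in X: u(x)>0\}}$ (closure in $X$). $C(X)$ and $K(X)$ denote the sets of all nonempty closed, respectively nonempty compact, subsets of $X$. $F_{USC}(X)$ is the set of fuzzy sets $u$ in $X$ with $[u]_\alpha\in C(X)\cup\{\emptyset\}$ for all $\alpha\in[0,1]$ (the upper semicontinuous fuzzy sets), and $F_{USCG}(X)=\{u\in F_{USC}(X): [u]_\alpha\in K(X)\cup\{\emptyset\}\text{ for all }\alpha\in(0,1]\}$. $X\times[0,1]$ carries the metric $\overline d((x,\alpha),(y,\beta))=d(x,y)+|\alpha-\beta|$. The endograph of $u$ is ${\rm end}\,u=\{(x,t)\in X\times[0,1]: u(x)\ge t\}$; for $u\in F_{USC}(X)$ it is a nonempty closed set. For nonempty closed $A,B\subseteq X\times[0,1]$, $H(A,B)=\max\{\sup_{a\in A}\inf_{b\in B}\overline d(a,b),\ \sup_{b\in B}\inf_{a\in A}\overline d(a,b)\}$.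 The endograph metric on $F_{USC}(X)$ and its subsets is $H_{\rm end}(u,v)=H({\rm end}\,u,{\rm end}\,v)$. For a set $U$ of fuzzy sets, $U(\alpha)=\bigcup_{u\in U}[u]_\alpha$ (an empty union is $\emptyset$; the empty set counts as compact). A subset $A$ of a metric space $Z$ is relatively compact in $Z$ if its closure in $Z$ is compact. *)

theory Defs
  imports "HOL-Analysis.Analysis"
begin

text \<open>The metric space \<open>X\<close> is the universe of a type of class \<^class>\<open>metric_space\<close> (types are
  nonempty). A fuzzy set is a real-valued function with values in \<open>[0,1]\<close>.\<close>

definition fuzzy_set :: "('a \<Rightarrow> real) \<Rightarrow> bool" where
  "fuzzy_set u \<longleftrightarrow> (\<forall>x. u x \<in> {0..1})"

text \<open>Only used for \<open>\<alpha> \<in> [0,1]\<close>.\<close>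

definition level_set :: "('a::metric_space \<Rightarrow> real) \<Rightarrow> real \<Rightarrow> 'a set" where
  "level_set u \<alpha> = (if \<alpha> = 0 then closure {x. u x > 0} else {x. u x \<ge> \<alpha>})"

text \<open>As \<open>C(X) \<union> {\<emptyset>}\<close> and \<open>K(X) \<union> {\<emptyset>}\<close> are all closed, respectively all compact, subsets of \<open>X\<close>,
  the empty set needs no separate mention.\<close>

definition F_USC :: "('a::metric_space \<Rightarrow> real) set" where
  "F_USC = {u. fuzzy_set u \<and> (\<forall>\<alpha>\<in>{0..1}. closed (level_set u \<alpha>))}"

definition F_USCG :: "('a::metric_space \<Rightarrow> real) set" where
  "F_USCG = {u \<in> F_USC. \<forall>\<alpha>\<in>{0<..1}. compact (level_set u \<alpha>)}"

text \<open>The sum metric on \<open>X \<times> [0,1]\<close>; \<^const>\<open>dist\<close> on the product type is the Euclidean combination.\<close>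

definition dbar :: "'a::metric_space \<times> real \<Rightarrow> 'a \<times> real \<Rightarrow> real" where
  "dbar p q = dist (fst p) (fst q) + \<bar>snd p - snd q\<bar>"

definition endograph :: "('a \<Rightarrow> real) \<Rightarrow> ('a \<times> real) set" where
  "endograph u = {(x, t). t \<in> {0..1} \<and> u x \<ge> t}"

text \<open>Extended-real valued, since the Hausdorff distance of unbounded sets may be infinite. The
  distance of endographs of fuzzy sets is at most 1 (\<open>hausdorff_endograph_le_1\<close>), so no information
  is lost by \<^const>\<open>enn2real\<close> in \<open>H_end\<close>.\<close>

definition hausdorff :: "('a::metric_space \<times> real) set \<Rightarrow> ('a \<times> real) set \<Rightarrow> ennreal" where
  "hausdorff A B = max (SUP a\<in>A. INF b\<in>B. ennreal (dbar a b)) (SUP b\<in>B. INF a\<in>A. ennreal (dbar a b))"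

definition H_end :: "('a::metric_space \<Rightarrow> real) \<Rightarrow> ('a \<Rightarrow> real) \<Rightarrow> real" where
  "H_end u v = enn2real (hausdorff (endograph u) (endograph v))"

definition level_union :: "('a::metric_space \<Rightarrow> real) set \<Rightarrow> real \<Rightarrow> 'a set" where
  "level_union U \<alpha> = (\<Union>u\<in>U. level_set u \<alpha>)"

definition relatively_compact :: "'a::metric_space set \<Rightarrow> bool" where
  "relatively_compact A \<longleftrightarrow> compact (closure A)"

text \<open>\<open>H_end\<close> is a metric on \<open>F_USC\<close> and hence on \<open>F_USCG\<close>, so that the topology
  \<open>Metric_space.mtopology F_USCG H_end\<close> is meaningful.\<close>

lemma dbar_commute: "dbar p q = dbar q p"
  by (simp add: dbar_def dist_commute abs_minus_commute)

lemma dbar_nonneg: "0 \<le> dbar p q"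
  by (simp add: dbar_def)

lemma dbar_triangle: "dbar p r \<le> dbar p q + dbar q r"
  using dist_triangle[of "fst p" "fst r" "fst q"] by (simp add: dbar_def)

lemma hausdorff_commute: "hausdorff A B = hausdorff B A"
  unfolding hausdorff_def
  by (subst max.commute, subst (1 2) dbar_commute, rule refl)

lemma hausdorff_INF_le: "a \<in> A \<Longrightarrow> (INF b\<in>B. ennreal (dbar a b)) \<le> hausdorff A B"
  unfolding hausdorff_def by (intro max.coboundedI1 SUP_upper)

lemma hausdorff_leI:
  assumes "\<And>a. a \<in> A \<Longrightarrow> (INF b\<in>B. ennreal (dbar a b)) \<le> e"
    and "\<And>b. b \<in> B \<Longrightarrow> (INF a\<in>A. ennreal (dbar b a)) \<le> e"
  shows "hausdorff A B \<le> e"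
  using assms unfolding hausdorff_def by (auto intro!: SUP_least simp: dbar_commute)

lemma INF_add_const_ennreal:
  fixes f :: "'b \<Rightarrow> ennreal"
  assumes "I \<noteq> {}"
  shows "(INF i\<in>I. f i + c) = (INF i\<in>I. f i) + c"
  using continuous_at_Inf_mono[of "\<lambda>x. x + c" "f ` I"] assms
  using continuous_add[of "at_right (Inf (f ` I))", of "\<lambda>x. x" "\<lambda>x. c"]
  by (auto simp: mono_def image_comp)

lemma hausdorff_triangle:
  assumes "B \<noteq> {}"
  shows "hausdorff A C \<le> hausdorff A B + hausdorff B C"
proof -
  have *: "(INF c\<in>C. ennreal (dbar a c)) \<le> hausdorff A B + hausdorff B C"
    if a: "a \<in> A" and "B \<noteq> {}" for a and A B C :: "('a \<times> real) set"
  proof -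
    have "(INF c\<in>C. ennreal (dbar a c)) \<le> ennreal (dbar a b) + hausdorff B C" if b: "b \<in> B" for b
    proof (cases "C = {}")
      case True
      then show ?thesis using hausdorff_INF_le[OF b, of C] by (simp add: top_unique)
    next
      case False
      have "(INF c\<in>C. ennreal (dbar a c)) \<le> (INF c\<in>C. ennreal (dbar b c) + ennreal (dbar a b))"
      proof (rule INF_mono)
        fix c assume "c \<in> C"
        have "ennreal (dbar a c) \<le> ennreal (dbar b c) + ennreal (dbar a b)"
          using dbar_triangle[of a c b]
          by (simp add: dbar_nonneg add.commute ennreal_leI flip: ennreal_plus)
        then show "\<exists>n\<in>C. ennreal (dbar a n) \<le> ennreal (dbar b c) + ennreal (dbar a b)"
          using \<open>c \<in> C\<close> by blast
      qed
      also have "\<dots> = (INF c\<in>C. ennreal (dbar b c)) + ennreal (dbar a b)"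
        using False by (rule INF_add_const_ennreal)
      also have "\<dots> \<le> ennreal (dbar a b) + hausdorff B C"
        using hausdorff_INF_le[OF b, of C] by (simp add: add.commute add_left_mono)
      finally show ?thesis .
    qed
    then have "(INF c\<in>C. ennreal (dbar a c)) \<le> (INF b\<in>B. ennreal (dbar a b) + hausdorff B C)"
      by (intro INF_greatest)
    also have "\<dots> = (INF b\<in>B. ennreal (dbar a b)) + hausdorff B C"
      using \<open>B \<noteq> {}\<close> by (rule INF_add_const_ennreal)
    also have "\<dots> \<le> hausdorff A B + hausdorff B C"
      using hausdorff_INF_le[OF a, of B] by (simp add: add_right_mono)
    finally show ?thesis .
  qed
  show ?thesis
  proof (rule hausdorff_leI)
    fix c assume "c \<in> C"
    then show "(INF a\<in>A. ennreal (dbar c a)) \<le> hausdorff A B + hausdorff B C"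
      using *[of c C B A] assms by (simp add: hausdorff_commute add.commute)
  qed (use * assms in blast)
qed

lemma hausdorff_endograph_le_1:
  assumes "fuzzy_set u" "fuzzy_set v"
  shows "hausdorff (endograph u) (endograph v) \<le> 1"
proof -
  have *: "(INF b\<in>endograph v. ennreal (dbar a b)) \<le> 1"
    if "a \<in> endograph u" "fuzzy_set v" for a and u v :: "'a \<Rightarrow> real"
  proof -
    have "(fst a, 0) \<in> endograph v" using that by (auto simp: endograph_def fuzzy_set_def)
    moreover have "ennreal (dbar a (fst a, 0)) \<le> 1"
      using that by (auto simp: endograph_def dbar_def)
    ultimately show ?thesis by (rule INF_lower2)
  qed
  show ?thesis using assms by (intro hausdorff_leI *)
qed

lemma hausdorff_endograph_eq:
  assumes "fuzzy_set u" "fuzzy_set v"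
  shows "hausdorff (endograph u) (endograph v) = ennreal (H_end u v)"
proof -
  have "hausdorff (endograph u) (endograph v) < top"
    using hausdorff_endograph_le_1[OF assms] ennreal_one_less_top by (rule le_less_trans)
  then show ?thesis by (simp add: H_end_def)
qed

lemma hausdorff_zero_imp_le:
  assumes u: "fuzzy_set u" and v: "v \<in> F_USC"
    and 0: "hausdorff (endograph u) (endograph v) = 0"
  shows "u x \<le> v x"
proof (rule dense_le)
  fix s assume s: "s < u x"
  show "s \<le> v x"
  proof (cases "s \<le> 0")
    case True
    then show ?thesis using v by (auto simp: F_USC_def fuzzy_set_def intro: order_trans)
  next
    case False
    have ux: "u x \<in> {0..1}" using u by (auto simp: fuzzy_set_def)
    then have mem: "(x, u x) \<in> endograph u" by (auto simp: endograph_def)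
    have "\<exists>y\<in>level_set v s. dist y x < e" if "e > 0" for e
    proof -
      let ?e = "min e (u x - s)"
      have "(INF b\<in>endograph v. ennreal (dbar (x, u x) b)) < ennreal ?e"
        using hausdorff_INF_le[OF mem, of "endograph v"] 0 s that by (simp add: le_less_trans)
      then obtain y t where "(y, t) \<in> endograph v" "ennreal (dbar (x, u x) (y, t)) < ennreal ?e"
        unfolding INF_less_iff by auto
      then have *: "t \<le> v y" "dbar (x, u x) (y, t) < ?e"
        using s that by (auto simp: endograph_def ennreal_less_iff dbar_nonneg)
      then have "dist x y + \<bar>u x - t\<bar> < ?e" by (simp add: dbar_def)
      then have "dist x y < e" "s \<le> t" using zero_le_dist[of x y] by linarith+
      then show ?thesis using * False by (intro bexI[of _ y]) (auto simp: level_set_def dist_commute)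
    qed
    then have "x \<in> closure (level_set v s)" by (simp add: closure_approachable)
    moreover have "closed (level_set v s)" using v s ux False by (auto simp: F_USC_def)
    ultimately show ?thesis using False by (simp add: level_set_def)
  qed
qed

lemma Metric_space_F_USC: "Metric_space F_USC H_end"
proof
  fix u v w :: "'a \<Rightarrow> real"
  show "0 \<le> H_end u v" "H_end u v = H_end v u"
    by (simp_all add: H_end_def hausdorff_commute)
  assume uv: "u \<in> F_USC" "v \<in> F_USC"
  then have fz: "fuzzy_set u" "fuzzy_set v" by (auto simp: F_USC_def)
  show "H_end u v = 0 \<longleftrightarrow> u = v"
  proof
    assume "H_end u v = 0"
    then have h: "hausdorff (endograph u) (endograph v) = 0"
      using hausdorff_endograph_eq[OF fz] by simp
    then have h': "hausdorff (endograph v) (endograph u) = 0"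
      by (simp add: hausdorff_commute)
    show "u = v"
      using hausdorff_zero_imp_le[OF fz(1) uv(2) h] hausdorff_zero_imp_le[OF fz(2) uv(1) h']
      by (auto simp: fun_eq_iff intro: antisym)
  next
    assume "u = v"
    moreover have "hausdorff (endograph u) (endograph u) \<le> 0"
      by (intro hausdorff_leI INF_lower2) (auto simp: dbar_def)
    ultimately show "H_end u v = 0" by (simp add: H_end_def)
  qed
  assume w: "w \<in> F_USC"
  then have fw: "fuzzy_set w" by (auto simp: F_USC_def)
  have "endograph v \<noteq> {}"
    using fz(2) by (auto simp: endograph_def fuzzy_set_def intro!: exI[of _ "0::real"])
  have nn: "0 \<le> H_end p q" for p q :: "'a \<Rightarrow> real" by (simp add: H_end_def)
  from hausdorff_triangle[OF \<open>endograph v \<noteq> {}\<close>, of "endograph u" "endograph w"]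
  have "ennreal (H_end u w) \<le> ennreal (H_end u v + H_end v w)"
    using nn by (simp add: hausdorff_endograph_eq fz fw)
  then show "H_end u w \<le> H_end u v + H_end v w"
    by (subst (asm) ennreal_le_iff) (auto simp: H_end_def)
qed

lemma Metric_space_F_USCG: "Metric_space F_USCG H_end"
  by (rule Metric_space.subspace[OF Metric_space_F_USC]) (auto simp: F_USCG_def)

end

theory Submission
  imports Defs
begin

text \<open>
  The endograph metric is blind to small heights: a point of an endograph of
  height at most \<open>e\<close> is within \<open>e\<close> of the base \<open>X \<times> {0}\<close>, which every endograph contains. At heights
  above \<open>e\<close> all endographs from \<open>U\<close> live in \<open>U(e) \<times> [0,1]\<close>, so relative compactness of the sets
  \<open>U(e)\<close> gives as much compactness as is needed.

  Suppose all \<open>U(\<alpha>)\<close> are relatively compact. A finite net of \<open>closure (U(e)) \<times> [0,1]\<close> sorts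
  the members of \<open>U\<close> into finitely many classes of small diameter, so \<open>U\<close> is totally bounded
  (\<open>mtotally_bounded_if_relatively_compact_levels\<close>). The endographs of a Cauchy sequence in \<open>U\<close>
  have a Kuratowski limit, which is again the endograph of a fuzzy set in \<^const>\<open>F_USCG\<close>; the
  convergence is in the Hausdorff sense because points of positive height cannot escape the compact
  sets \<open>closure (U(e))\<close> (\<open>MCauchy_converges_if_relatively_compact_levels\<close>). When \<open>U\<close> is
  closed the limit stays in \<open>U\<close>, and \<open>U\<close> is sequentially compact.

  Conversely, let \<open>U\<close> be compact and take points \<open>x n\<close> in \<open>U(\<alpha>)\<close>, with \<open>\<sigma> n x n \<ge> \<alpha>\<close>. Along a subsequence
  \<open>\<sigma> n\<close> tends to some \<open>u\<close> in \<open>U\<close>, so the points \<open>(x n, \<alpha>)\<close> approach the part of the endograph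
  of \<open>u\<close> over the compact set \<open>[u](\<alpha>/2)\<close> and hence cluster at a point of the closed endograph
  (\<open>compact_level_union\<close>).
\<close>

section \<open>Endographs and the endograph metric\<close>

lemma dist_le_dbar: "dist p q \<le> dbar p q"
  unfolding dist_prod_def dbar_def dist_real_def
  by (rule sqrt_sum_squares_le_sum) auto

lemma dbar_le_dist: "dbar p q \<le> 2 * dist p q"
  using dist_fst_le[of p q] dist_snd_le[of p q] by (simp add: dbar_def dist_real_def)

lemma abs_snd_diff_le_dbar: "\<bar>snd p - snd q\<bar> \<le> dbar p q"
  by (simp add: dbar_def)

lemma dist_fst_le_dbar: "dist (fst p) (fst q) \<le> dbar p q"
  by (simp add: dbar_def)

lemma tendsto_imp_dbar_less:
  assumes "p \<longlonglongrightarrow> q" and "0 < e"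
  shows "\<forall>\<^sub>F n in sequentially. dbar (p n) q < e"
proof -
  have "\<forall>\<^sub>F n in sequentially. dist (p n) q < e / 2"
    using assms by (intro tendstoD) auto
  then show ?thesis
  proof (rule eventually_mono)
    show "dbar (p n) q < e" if "dist (p n) q < e / 2" for n
      using that dbar_le_dist[of "p n" q] by linarith
  qed
qed

lemma fuzzy_set_F_USCG: "u \<in> F_USCG \<Longrightarrow> fuzzy_set u"
  by (simp add: F_USCG_def F_USC_def)

lemma base_in_endograph: "fuzzy_set u \<Longrightarrow> (x, 0) \<in> endograph u"
  by (simp add: endograph_def fuzzy_set_def)

lemma H_end_lessD:
  assumes "fuzzy_set u" "fuzzy_set v" and less: "H_end u v < e" and a: "a \<in> endograph u"
  shows "\<exists>b\<in>endograph v. dbar a b < e"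
proof -
  have "0 \<le> H_end u v" by (simp add: H_end_def)
  then have "hausdorff (endograph u) (endograph v) < ennreal e"
    using less \<open>0 \<le> H_end u v\<close> by (simp add: hausdorff_endograph_eq assms(1,2) ennreal_less_iff)
  then have "(INF b\<in>endograph v. ennreal (dbar a b)) < ennreal e"
    using hausdorff_INF_le[OF a] by (rule le_less_trans[rotated])
  then show ?thesis
    unfolding INF_less_iff by (auto simp: ennreal_less_iff dbar_nonneg)
qed

lemma H_end_leI:
  assumes "fuzzy_set u" "fuzzy_set v" "0 \<le> e"
    and "\<And>a. a \<in> endograph u \<Longrightarrow> \<exists>b\<in>endograph v. dbar a b \<le> e"
    and "\<And>b. b \<in> endograph v \<Longrightarrow> \<exists>a\<in>endograph u. dbar b a \<le> e"
  shows "H_end u v \<le> e"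
proof -
  have "hausdorff (endograph u) (endograph v) \<le> ennreal e"
    by (rule hausdorff_leI) (meson assms(4,5) INF_lower2 ennreal_leI)+
  then show ?thesis
    by (simp add: hausdorff_endograph_eq assms(1-3))
qed

lemma F_USCG_I:
  assumes "fuzzy_set u" and "\<And>\<alpha>. \<lbrakk>0 < \<alpha>; \<alpha> \<le> 1\<rbrakk> \<Longrightarrow> compact {x. \<alpha> \<le> u x}"
  shows "u \<in> F_USCG"
  using assms by (auto simp: F_USCG_def F_USC_def level_set_def compact_imp_closed)

lemma fst_in_level_union:
  assumes "u \<in> U" "p \<in> endograph u" "0 < \<alpha>" "\<alpha> \<le> snd p"
  shows "fst p \<in> level_union U \<alpha>"
  using assms by (auto simp: level_union_def level_set_def endograph_def intro!: bexI[of _ u])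

text \<open>Closedness is what makes the suprema of the fibres attained.\<close>

lemma closed_subgraph_is_endograph:
  fixes E :: "('a::metric_space \<times> real) set"
  assumes "closed E" and sub: "E \<subseteq> UNIV \<times> {0..1}" and base: "\<And>x. (x, 0) \<in> E"
    and down: "\<And>x s t. \<lbrakk>(x, t) \<in> E; 0 \<le> s; s \<le> t\<rbrakk> \<Longrightarrow> (x, s) \<in> E"
  obtains u where "fuzzy_set u" "endograph u = E"
proof -
  define u where "u x = Sup {t. (x, t) \<in> E}" for x
  have ne: "{t. (x, t) \<in> E} \<noteq> {}" for x
    using base by blast
  have bdd: "bdd_above {t. (x, t) \<in> E}" for x
    using sub by (intro bdd_aboveI[of _ 1]) auto
  have "closed (Pair x -` E)" for x
    using \<open>closed E\<close> by (intro closed_vimage continuous_intros)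
  then have u_in: "(x, u x) \<in> E" for x
    using closed_contains_Sup[OF ne bdd, of x] by (simp add: u_def vimage_def)
  then have "fuzzy_set u"
    using sub unfolding fuzzy_set_def by blast
  moreover have "endograph u = E"
  proof (intro set_eqI, clarify)
    fix x t
    show "(x, t) \<in> endograph u \<longleftrightarrow> (x, t) \<in> E"
      using u_in[of x] down[of x "u x" t] sub cSup_upper[OF _ bdd, of t x]
      by (auto simp: endograph_def u_def)
  qed
  ultimately show thesis by (rule that)
qed

section \<open>Total boundedness\<close>

text \<open>Two fuzzy sets whose endographs come close to the same points of the net are close to each
  other; the net has only finitely many subsets.\<close>

lemma mtotally_bounded_if_relatively_compact_levels:
  fixes U :: "('a::metric_space \<Rightarrow> real) set"
  assumes U: "U \<subseteq> F_USCG"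
    and rc: "\<And>\<alpha>. \<alpha> \<in> {0<..1} \<Longrightarrow> relatively_compact (level_union U \<alpha>)"
  shows "Metric_space.mtotally_bounded F_USCG H_end U"
proof -
  interpret Metric_space F_USCG "H_end :: ('a \<Rightarrow> real) \<Rightarrow> _" by (rule Metric_space_F_USCG)
  have fz: "fuzzy_set u" if "u \<in> U" for u
    using that U fuzzy_set_F_USCG by blast
  show ?thesis
    unfolding mtotally_bounded_def
  proof (intro allI impI)
    fix e' :: real assume "e' > 0"
    \<comment> \<open>Members of one class turn out to be at distance at most \<open>4 * e\<close>.\<close>
    define e where "e = min 1 (e' / 5)"
    have e: "0 < e" "e \<le> 1" "4 * e < e'" using \<open>e' > 0\<close> by (auto simp: e_def min_def)
    define K where "K = closure (level_union U e) \<times> {0..1::real}"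
    have "compact K"
      using rc[of e] e by (auto simp: K_def relatively_compact_def intro: compact_Times)
    then obtain N where N: "finite N" "K \<subseteq> (\<Union>p\<in>N. ball p e)"
      using e(1) seq_compact_imp_totally_bounded[of K] by (auto simp: compact_eq_seq_compact_metric)
    define G where "G u = {p \<in> N. \<exists>b\<in>endograph u. dbar p b < 2 * e}" for u :: "'a \<Rightarrow> real"
    have near: "\<exists>b\<in>endograph v. dbar a b \<le> 4 * e"
      if uv: "u \<in> U" "v \<in> U" "G u = G v" and a: "a \<in> endograph u" for u v a
    proof (cases "snd a \<le> e")
      case True
      then have "dbar a (fst a, 0) \<le> 4 * e" using a e by (auto simp: dbar_def endograph_def)
      then show ?thesis using base_in_endograph[OF fz[OF uv(2)]] by blast
    next
      case False
      then have "fst a \<in> level_union U e"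
        using fst_in_level_union[OF uv(1) a e(1)] by simp
      then have "a \<in> K"
        using a closure_subset by (fastforce simp: K_def endograph_def)
      then obtain p where p: "p \<in> N" "dist p a < e" using N by auto
      then have pa: "dbar p a < 2 * e" using dbar_le_dist[of p a] by linarith
      then have "p \<in> G v" using p a uv(3) by (auto simp: G_def)
      then obtain b where b: "b \<in> endograph v" "dbar p b < 2 * e" by (auto simp: G_def)
      then have "dbar a b \<le> 4 * e"
        using pa dbar_triangle[of a b p] dbar_commute[of a p] by linarith
      then show ?thesis using b by blast
    qed
    have "finite (G ` U)"
      using N(1) by (rule finite_subset[rotated, OF finite_Pow_iff[THEN iffD2]]) (auto simp: G_def)
    then obtain C where C: "C \<subseteq> U" "finite C" "G ` U = G ` C"
      using finite_subset_image[of "G ` U" G U] by auto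
    have "U \<subseteq> (\<Union>v\<in>C. mball v e')"
    proof
      fix u assume u: "u \<in> U"
      then obtain v where v: "v \<in> C" "G u = G v" using C(3) by (metis imageE imageI)
      then have "v \<in> U" using C by auto
      then have "H_end v u \<le> 4 * e"
        using u v e near[of u v] near[of v u] by (intro H_end_leI fz) auto
      then show "u \<in> (\<Union>v\<in>C. mball v e')"
        using e U u v \<open>v \<in> U\<close> by (auto simp: in_mball intro!: bexI[of _ v])
    qed
    then show "\<exists>K. finite K \<and> K \<subseteq> U \<and> U \<subseteq> (\<Union>x\<in>K. mball x e')"
      using C by blast
  qed
qed

section \<open>Limits of Cauchy sequences\<close>

definition kuratowski_liminf :: "(nat \<Rightarrow> ('a::metric_space \<times> real) set) \<Rightarrow> ('a \<times> real) set" where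
  "kuratowski_liminf A = {p. \<forall>e>0. \<forall>\<^sub>F n in sequentially. \<exists>b\<in>A n. dbar p b < e}"

lemma closed_kuratowski_liminf: "closed (kuratowski_liminf A)"
proof -
  have "p \<in> kuratowski_liminf A" if p: "p \<in> closure (kuratowski_liminf A)" for p
    unfolding kuratowski_liminf_def
  proof (intro CollectI allI impI)
    fix e :: real assume "e > 0"
    then obtain q where q: "q \<in> kuratowski_liminf A" "dist q p < e / 4"
      using p unfolding closure_approachable by (meson divide_pos_pos zero_less_numeral)
    have "dbar p q < e / 2"
      using dbar_le_dist[of p q] q by (simp add: dist_commute)
    moreover have "\<forall>\<^sub>F n in sequentially. \<exists>b\<in>A n. dbar q b < e / 2"
      using q(1) half_gt_zero[OF \<open>e > 0\<close>] unfolding kuratowski_liminf_def by blast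
    ultimately show "\<forall>\<^sub>F n in sequentially. \<exists>b\<in>A n. dbar p b < e"
    proof (elim eventually_mono bexE)
      fix n b assume "dbar p q < e / 2" "b \<in> A n" "dbar q b < e / 2"
      then show "\<exists>b\<in>A n. dbar p b < e"
        using dbar_triangle[of p b q] by (intro bexI[of _ b]) linarith+
    qed
  qed
  then show ?thesis by (metis closure_subset closure_eq subsetI subset_antisym)
qed

text \<open>For a Cauchy sequence the lower and the upper Kuratowski limit coincide.\<close>

lemma cluster_in_kuratowski_liminf:
  fixes \<sigma> :: "nat \<Rightarrow> 'a::metric_space \<Rightarrow> real"
  assumes fz: "\<And>n. fuzzy_set (\<sigma> n)"
    and Cauchy: "\<And>e. e > 0 \<Longrightarrow> \<exists>N. \<forall>m\<ge>N. \<forall>n\<ge>N. H_end (\<sigma> m) (\<sigma> n) < e"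
    and cluster: "\<And>e. e > 0 \<Longrightarrow> \<exists>\<^sub>F n in sequentially. \<exists>b\<in>endograph (\<sigma> n). dbar p b < e"
  shows "p \<in> kuratowski_liminf (\<lambda>n. endograph (\<sigma> n))"
  unfolding kuratowski_liminf_def
proof (intro CollectI allI impI)
  fix e :: real assume "e > 0"
  then obtain N where N: "\<And>m n. \<lbrakk>m \<ge> N; n \<ge> N\<rbrakk> \<Longrightarrow> H_end (\<sigma> m) (\<sigma> n) < e / 2"
    using Cauchy[of "e / 2"] by auto
  obtain m b where m: "m \<ge> N" "b \<in> endograph (\<sigma> m)" "dbar p b < e / 2"
    using cluster[of "e / 2"] \<open>e > 0\<close> unfolding frequently_sequentially by (meson half_gt_zero)
  have "\<exists>c\<in>endograph (\<sigma> n). dbar p c < e" if "n \<ge> N" for n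
    using H_end_lessD[OF fz fz N[OF m(1) that] m(2)] m(3) by (smt (verit) dbar_triangle field_sum_of_halves)
  then show "\<forall>\<^sub>F n in sequentially. \<exists>b\<in>endograph (\<sigma> n). dbar p b < e"
    unfolding eventually_sequentially by blast
qed

lemma kuratowski_liminf_endographs_subgraph:
  assumes fz: "\<And>n. fuzzy_set (\<sigma> n)"
  defines "E \<equiv> kuratowski_liminf (\<lambda>n. endograph (\<sigma> n))"
  shows "E \<subseteq> UNIV \<times> {0..1}"
    and "(x, 0) \<in> E"
    and "\<lbrakk>(x, t) \<in> E; 0 \<le> s; s \<le> t\<rbrakk> \<Longrightarrow> (x, s) \<in> E"
proof -
  show "E \<subseteq> UNIV \<times> {0..1}"
  proof (rule subrelI)
    fix y r assume yr: "(y, r) \<in> E"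
    have approx: "\<exists>s\<in>{0..1}. \<bar>r - s\<bar> < e" if "e > 0" for e
    proof -
      from yr that have "\<forall>\<^sub>F n in sequentially. \<exists>b\<in>endograph (\<sigma> n). dbar (y, r) b < e"
        by (auto simp: E_def kuratowski_liminf_def)
      then obtain n b where b: "b \<in> endograph (\<sigma> n)" "dbar (y, r) b < e"
        by (auto dest: eventually_happens)
      then show ?thesis
        using abs_snd_diff_le_dbar[of "(y, r)" b] by (intro bexI[of _ "snd b"]) (auto simp: endograph_def)
    qed
    have "r \<in> closure {0..1}"
      unfolding closure_approachable using approx by (auto simp: dist_real_def abs_minus_commute)
    then show "(y, r) \<in> UNIV \<times> {0..1}" by simp
  qed
  show "(x, 0) \<in> E"
    using base_in_endograph[OF fz] unfolding E_def kuratowski_liminf_def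
    by (auto intro!: always_eventually bexI[of _ "(x, 0)"] simp: dbar_def)
  show "(x, s) \<in> E" if xt: "(x, t) \<in> E" and s: "0 \<le> s" "s \<le> t"
    unfolding E_def kuratowski_liminf_def
  proof (intro CollectI allI impI)
    fix e :: real assume "e > 0"
    then have "\<forall>\<^sub>F n in sequentially. \<exists>b\<in>endograph (\<sigma> n). dbar (x, t) b < e"
      using xt by (simp add: E_def kuratowski_liminf_def)
    then show "\<forall>\<^sub>F n in sequentially. \<exists>b\<in>endograph (\<sigma> n). dbar (x, s) b < e"
    proof (rule eventually_mono)
      fix n assume "\<exists>b\<in>endograph (\<sigma> n). dbar (x, t) b < e"
      then obtain y r where "(y, r) \<in> endograph (\<sigma> n)" "dbar (x, t) (y, r) < e" by auto
      \<comment> \<open>Cutting a height down to \<open>s\<close> does not increase the distance, since \<open>s \<le> t\<close>.\<close>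
      then show "\<exists>b\<in>endograph (\<sigma> n). dbar (x, s) b < e"
        using s by (intro bexI[of _ "(y, min r s)"]) (auto simp: dbar_def endograph_def min_def)
    qed
  qed
qed

text \<open>Compactness of the level unions enters twice: the level sets of the limit are compact, and
  a point of positive height that is near all later endographs is near their limit.\<close>

lemma MCauchy_converges_if_relatively_compact_levels:
  fixes U :: "('a::metric_space \<Rightarrow> real) set"
  assumes U: "U \<subseteq> F_USCG"
    and rc: "\<And>\<alpha>. \<alpha> \<in> {0<..1} \<Longrightarrow> relatively_compact (level_union U \<alpha>)"
    and \<sigma>: "range \<sigma> \<subseteq> U" "Metric_space.MCauchy F_USCG H_end \<sigma>"
  obtains u where "limitin (Metric_space.mtopology F_USCG H_end) \<sigma> u sequentially"
proof -
  interpret Metric_space F_USCG "H_end :: ('a \<Rightarrow> real) \<Rightarrow> _" by (rule Metric_space_F_USCG)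
  have \<sigma>U: "\<sigma> n \<in> U" for n using \<sigma>(1) by auto
  have fz: "fuzzy_set (\<sigma> n)" for n
    using \<sigma>U U fuzzy_set_F_USCG by blast
  have Cauchy: "\<exists>N. \<forall>m\<ge>N. \<forall>n\<ge>N. H_end (\<sigma> m) (\<sigma> n) < e" if "e > 0" for e
    using \<sigma>(2) that unfolding MCauchy_def by meson
  define E where "E = kuratowski_liminf (\<lambda>n. endograph (\<sigma> n))"
  have "closed E" unfolding E_def by (rule closed_kuratowski_liminf)
  then obtain u where u: "fuzzy_set u" "endograph u = E"
    by (rule closed_subgraph_is_endograph)
      (use kuratowski_liminf_endographs_subgraph[OF fz] in \<open>auto simp: E_def\<close>)
  have "u \<in> F_USCG"
  proof (rule F_USCG_I[OF u(1)])
    fix \<alpha> :: real assume \<alpha>: "0 < \<alpha>" "\<alpha> \<le> 1"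
    have level: "{x. \<alpha> \<le> u x} = (\<lambda>x. (x, \<alpha>)) -` E"
      using \<alpha> by (auto simp: endograph_def simp flip: u(2))
    have "closed {x. \<alpha> \<le> u x}"
      unfolding level using \<open>closed E\<close> by (intro closed_vimage continuous_intros)
    moreover have "{x. \<alpha> \<le> u x} \<subseteq> closure (level_union U (\<alpha> / 2))"
    proof
      fix x assume "x \<in> {x. \<alpha> \<le> u x}"
      then have "(x, \<alpha>) \<in> E" using level by auto
      have "\<exists>y\<in>level_union U (\<alpha> / 2). dist y x < e" if "e > 0" for e
      proof -
        have "\<forall>\<^sub>F n in sequentially. \<exists>b\<in>endograph (\<sigma> n). dbar (x, \<alpha>) b < min e (\<alpha> / 2)"
          using \<open>(x, \<alpha>) \<in> E\<close> \<alpha> that by (auto simp: E_def kuratowski_liminf_def simp del: min_less_iff_conj)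
        then obtain n b where b: "b \<in> endograph (\<sigma> n)" "dbar (x, \<alpha>) b < min e (\<alpha> / 2)"
          by (auto dest: eventually_happens)
        then have "\<alpha> / 2 \<le> snd b" "dist (fst b) x < e"
          using abs_snd_diff_le_dbar[of "(x, \<alpha>)" b] dist_fst_le_dbar[of "(x, \<alpha>)" b]
          by (auto simp: dist_commute)
        then show ?thesis
          using fst_in_level_union[OF \<sigma>U b(1)] \<alpha> by auto
      qed
      then show "x \<in> closure (level_union U (\<alpha> / 2))" by (simp add: closure_approachable)
    qed
    moreover have "compact (closure (level_union U (\<alpha> / 2)))"
      using rc[of "\<alpha> / 2"] \<alpha> by (simp add: relatively_compact_def)
    ultimately show "compact {x. \<alpha> \<le> u x}"
      by (metis compact_Int_closed inf.absorb_iff2)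
  qed
  have near_limit: "\<exists>q\<in>E. dbar p q \<le> 2 * e"
    if e: "e > 0" and p: "p \<in> endograph (\<sigma> n)" and close: "\<And>m. m \<ge> n \<Longrightarrow> H_end (\<sigma> n) (\<sigma> m) < e" for e p n
  proof (cases "snd p \<le> 2 * e")
    case True
    then have "dbar p (fst p, 0) \<le> 2 * e"
      using p by (auto simp: dbar_def endograph_def)
    then show ?thesis using base_in_endograph[OF u(1)] u(2) by blast
  next
    case False
    \<comment> \<open>Nearby points of the later endographs all have height at least \<open>e\<close>, so they cluster.\<close>
    have "\<exists>b\<in>endograph (\<sigma> (n + m)). dbar p b < e" for m
      by (rule H_end_lessD[OF fz fz close p]) simp
    then obtain b where b: "\<And>m. b m \<in> endograph (\<sigma> (n + m))" "\<And>m. dbar p (b m) < e" by metis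
    have "e \<le> 1" using p False e by (auto simp: endograph_def)
    have "e \<le> snd (b m)" for m
      using abs_snd_diff_le_dbar[of p "b m"] b(2)[of m] False by linarith
    then have fst_b: "fst (b m) \<in> level_union U e" for m
      using fst_in_level_union[OF \<sigma>U b(1)] e by blast
    have "b m \<in> closure (level_union U e) \<times> {0..1}" for m
      using b(1)[of m] subsetD[OF closure_subset fst_b[of m]] by (cases "b m") (auto simp: endograph_def)
    moreover have "compact (closure (level_union U e) \<times> {0..1::real})"
      using rc[of e] e \<open>e \<le> 1\<close> by (auto simp: relatively_compact_def intro: compact_Times)
    ultimately obtain q r where r: "strict_mono r" "(b \<circ> r) \<longlonglongrightarrow> q"
      unfolding compact_def by meson
    have "q \<in> E"
      unfolding E_def
    proof (rule cluster_in_kuratowski_liminf[OF fz Cauchy])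
      fix d :: real assume "d > 0"
      from tendsto_imp_dbar_less[OF r(2) this] obtain M where M: "\<And>k. k \<ge> M \<Longrightarrow> dbar (b (r k)) q < d"
        by (auto simp: eventually_sequentially)
      show "\<exists>\<^sub>F m in sequentially. \<exists>c\<in>endograph (\<sigma> m). dbar q c < d"
        unfolding frequently_sequentially
      proof
        fix N
        let ?k = "max N M"
        have "n + r ?k \<ge> N" using seq_suble[OF r(1), of ?k] by linarith
        then show "\<exists>m\<ge>N. \<exists>c\<in>endograph (\<sigma> m). dbar q c < d"
          using b(1)[of "r ?k"] M[of ?k] by (auto simp: dbar_commute intro!: exI[of _ "n + r ?k"] bexI[of _ "b (r ?k)"])
      qed
    qed
    moreover from tendsto_imp_dbar_less[OF r(2) e] obtain k where "dbar (b (r k)) q < e"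
      by (auto simp: eventually_sequentially)
    then have "dbar p q \<le> 2 * e"
      using b(2)[of "r k"] dbar_triangle[of p q "b (r k)"] by linarith
    ultimately show ?thesis by blast
  qed
  have "limitin mtopology \<sigma> u sequentially"
    unfolding limit_metric_sequentially
  proof (intro conjI allI impI)
    show "u \<in> F_USCG" by fact
    fix e' :: real assume "e' > 0"
    define e where "e = e' / 3"
    have e: "e > 0" "2 * e < e'" using \<open>e' > 0\<close> by (auto simp: e_def)
    obtain N where N: "\<And>m n. \<lbrakk>m \<ge> N; n \<ge> N\<rbrakk> \<Longrightarrow> H_end (\<sigma> m) (\<sigma> n) < e"
      using Cauchy[OF e(1)] by auto
    have "H_end (\<sigma> n) u \<le> 2 * e" if n: "n \<ge> N" for n
    proof (rule H_end_leI[OF fz u(1)])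
      show "0 \<le> 2 * e" using e by simp
      show "\<exists>q\<in>endograph u. dbar p q \<le> 2 * e" if "p \<in> endograph (\<sigma> n)" for p
        using near_limit[OF e(1) that] N n u(2) by auto
      fix q assume "q \<in> endograph u"
      then have "\<forall>\<^sub>F m in sequentially. \<exists>b\<in>endograph (\<sigma> m). dbar q b < e"
        using u(2) e by (auto simp: E_def kuratowski_liminf_def)
      then obtain m b where m: "m \<ge> N" "b \<in> endograph (\<sigma> m)" "dbar q b < e"
        unfolding eventually_sequentially by (meson max.cobounded1 max.cobounded2)
      then obtain c where "c \<in> endograph (\<sigma> n)" "dbar b c < e"
        using H_end_lessD[OF fz fz N] n by blast
      then show "\<exists>c\<in>endograph (\<sigma> n). dbar q c \<le> 2 * e"
        using m(3) dbar_triangle[of q c b] by (intro bexI[of _ c]) auto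
    qed
    then show "\<exists>N. \<forall>n\<ge>N. \<sigma> n \<in> F_USCG \<and> H_end (\<sigma> n) u < e'"
      using e \<sigma>U U by (meson le_less_trans subsetD)
  qed
  then show thesis by (rule that)
qed

section \<open>Level unions of compact sets\<close>

text \<open>The limit \<open>u\<close> of a subsequence of witnesses supplies the compact set in which the points
  cluster: they are asymptotically close to \<open>[u](\<alpha>/2)\<close>, at heights tending to \<open>\<alpha>\<close>.\<close>

lemma compact_level_union:
  fixes U :: "('a::metric_space \<Rightarrow> real) set"
  assumes compact: "compactin (Metric_space.mtopology F_USCG H_end) U" and \<alpha>: "\<alpha> \<in> {0<..1}"
  shows "compact (level_union U \<alpha>)"
  unfolding compact_def
proof (intro allI impI)
  interpret Metric_space F_USCG "H_end :: ('a \<Rightarrow> real) \<Rightarrow> _" by (rule Metric_space_F_USCG)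
  fix x :: "nat \<Rightarrow> 'a" assume "\<forall>n. x n \<in> level_union U \<alpha>"
  then have "\<forall>n. \<exists>u\<in>U. \<alpha> \<le> u (x n)"
    using \<alpha> by (auto simp: level_union_def level_set_def)
  then obtain \<sigma> where \<sigma>: "\<And>n. \<sigma> n \<in> U" "\<And>n. \<alpha> \<le> \<sigma> n (x n)" by metis
  have "range \<sigma> \<subseteq> U" using \<sigma> by auto
  then obtain u r where u: "u \<in> U" and r: "strict_mono r"
    and lim: "limitin mtopology (\<sigma> \<circ> r) u sequentially"
    using compact unfolding compactin_sequentially by meson
  have U: "U \<subseteq> F_USCG" using compact by (simp add: compactin_sequentially)
  then have fz: "fuzzy_set v" if "v \<in> U" for v using that fuzzy_set_F_USCG by blast
  have u_level: "compact {y. \<beta> \<le> u y}" if "0 < \<beta>" "\<beta> \<le> 1" for \<beta>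
    using u U that by (auto simp: F_USCG_def level_set_def)
  \<comment> \<open>The Hausdorff distance need not be attained, hence the vanishing slack \<open>1 / Suc n\<close>.\<close>
  have "\<exists>b\<in>endograph u. dbar (x (r n), \<alpha>) b < H_end (\<sigma> (r n)) u + 1 / Suc n" for n
    using \<sigma>(2)[of "r n"] \<alpha> by (intro H_end_lessD[OF fz[OF \<sigma>(1)] fz[OF u]]) (auto simp: endograph_def)
  then obtain b where b: "\<And>n. b n \<in> endograph u"
    "\<And>n. dbar (x (r n), \<alpha>) (b n) < H_end (\<sigma> (r n)) u + 1 / Suc n" by metis
  have "(\<lambda>n. H_end (\<sigma> (r n)) u) \<longlonglongrightarrow> 0"
    using lim by (simp add: limitin_metric_dist_null o_def)
  then have "(\<lambda>n. H_end (\<sigma> (r n)) u + 1 / Suc n) \<longlonglongrightarrow> 0"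
    using tendsto_add[OF _ LIMSEQ_Suc[OF lim_1_over_n]] by force
  then have dbar_0: "(\<lambda>n. dbar (x (r n), \<alpha>) (b n)) \<longlonglongrightarrow> 0"
    by (rule tendsto_sandwich[OF _ _ tendsto_const, rotated 2])
      (use b(2) in \<open>auto intro!: always_eventually less_imp_le simp: dbar_nonneg\<close>)
  then have "\<forall>\<^sub>F n in sequentially. dbar (x (r n), \<alpha>) (b n) < \<alpha> / 2"
    using \<alpha> by (intro order_tendstoD) auto
  then obtain N where N: "\<And>n. n \<ge> N \<Longrightarrow> dbar (x (r n), \<alpha>) (b n) < \<alpha> / 2"
    by (auto simp: eventually_sequentially)
  have "fst (b (n + N)) \<in> {y. \<alpha> / 2 \<le> u y}" for n
    using N[of "n + N"] b(1)[of "n + N"] abs_snd_diff_le_dbar[of "(x (r (n + N)), \<alpha>)" "b (n + N)"]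
    by (auto simp: endograph_def)
  moreover have "compact {y. \<alpha> / 2 \<le> u y}" using \<alpha> by (intro u_level) auto
  ultimately obtain y s where s: "strict_mono s" "((\<lambda>n. fst (b (n + N))) \<circ> s) \<longlonglongrightarrow> y"
    unfolding compact_def by (metis (no_types, lifting))
  define k where "k n = s n + N" for n
  have k: "strict_mono k" using s(1) by (auto simp: k_def strict_mono_def)
  have fst_lim: "(\<lambda>n. fst (b (k n))) \<longlonglongrightarrow> y" using s(2) by (simp add: o_def k_def)
  have dbar_k: "(\<lambda>n. dbar (x (r (k n)), \<alpha>) (b (k n))) \<longlonglongrightarrow> 0"
    using LIMSEQ_subseq_LIMSEQ[OF dbar_0 k] by (simp add: o_def)
  have "(\<lambda>n. dist (x (r (k n))) (fst (b (k n)))) \<longlonglongrightarrow> 0"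
    by (rule tendsto_sandwich[OF _ _ tendsto_const dbar_k]) (auto simp: dbar_def)
  then have "(\<lambda>n. dist (x (r (k n))) (fst (b (k n))) + dist (fst (b (k n))) y) \<longlonglongrightarrow> 0"
    using tendsto_add fst_lim[THEN tendsto_dist_iff[THEN iffD1]] by fastforce
  then have "(\<lambda>n. dist (x (r (k n))) y) \<longlonglongrightarrow> 0"
    by (rule tendsto_sandwich[OF _ _ tendsto_const, rotated 2]) (auto simp: dist_triangle)
  then have "(\<lambda>n. x (r (k n))) \<longlonglongrightarrow> y"
    by (rule tendsto_dist_iff[THEN iffD2])
  have "(\<lambda>n. snd (b (k n)) - \<alpha>) \<longlonglongrightarrow> 0"
    by (rule Lim_null_comparison[OF always_eventually dbar_k])
      (simp add: dbar_def abs_minus_commute)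
  then have snd_lim: "(\<lambda>n. snd (b (k n))) \<longlonglongrightarrow> \<alpha>"
    by (simp add: LIM_zero_iff)
  have "\<alpha> \<le> u y"
  proof (rule dense_le)
    fix \<beta> assume "\<beta> < \<alpha>"
    \<comment> \<open>The approximating heights only tend to \<open>\<alpha>\<close>, so \<open>y\<close> is first put into levels below
      \<open>\<alpha>\<close>; these are kept positive, where level sets are closed.\<close>
    define \<gamma> where "\<gamma> = max \<beta> (\<alpha> / 2)"
    have \<gamma>: "0 < \<gamma>" "\<gamma> < \<alpha>" "\<gamma> \<le> 1" using \<open>\<beta> < \<alpha>\<close> \<alpha> by (auto simp: \<gamma>_def)
    have "\<forall>\<^sub>F n in sequentially. \<gamma> < snd (b (k n))"
      using order_tendstoD(1)[OF snd_lim \<gamma>(2)] .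
    moreover have "snd (b (k n)) \<le> u (fst (b (k n)))" for n
      using b(1)[of "k n"] by (auto simp: endograph_def)
    ultimately have "\<forall>\<^sub>F n in sequentially. fst (b (k n)) \<in> {y. \<gamma> \<le> u y}"
      by (auto elim!: eventually_mono intro: less_imp_le less_le_trans)
    then have "y \<in> {y. \<gamma> \<le> u y}"
      using Lim_in_closed_set[OF compact_imp_closed[OF u_level] _ _ fst_lim] \<gamma> by auto
    then show "\<beta> \<le> u y" by (simp add: \<gamma>_def)
  qed
  then have "y \<in> level_union U \<alpha>" using u \<alpha> by (auto simp: level_union_def level_set_def)
  moreover have "strict_mono (r \<circ> k)" using r k by (simp add: strict_mono_o)
  ultimately show "\<exists>l\<in>level_union U \<alpha>. \<exists>r. strict_mono r \<and> (x \<circ> r) \<longlonglongrightarrow> l"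
    using \<open>(\<lambda>n. x (r (k n))) \<longlonglongrightarrow> y\<close> by (auto simp: o_def intro!: bexI[of _ y] exI[of _ "r \<circ> k"])
qed

section \<open>The characterisation of compactness\<close>

lemma compactin_if_relatively_compact_levels:
  fixes U :: "('a::metric_space \<Rightarrow> real) set"
  assumes U: "U \<subseteq> F_USCG"
    and rc: "\<And>\<alpha>. \<alpha> \<in> {0<..1} \<Longrightarrow> relatively_compact (level_union U \<alpha>)"
    and closed: "closedin (Metric_space.mtopology F_USCG H_end) U"
  shows "compactin (Metric_space.mtopology F_USCG H_end) U"
proof -
  interpret Metric_space F_USCG "H_end :: ('a \<Rightarrow> real) \<Rightarrow> _" by (rule Metric_space_F_USCG)
  show ?thesis
    unfolding compactin_sequentially
  proof (intro conjI U allI impI)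
    fix \<sigma> :: "nat \<Rightarrow> 'a \<Rightarrow> real" assume \<sigma>: "range \<sigma> \<subseteq> U"
    then obtain r where r: "strict_mono r" "MCauchy (\<sigma> \<circ> r)"
      using mtotally_bounded_if_relatively_compact_levels[OF U rc]
      unfolding mtotally_bounded_sequentially by meson
    have sub: "range (\<sigma> \<circ> r) \<subseteq> U" using \<sigma> by auto
    obtain u where u: "limitin mtopology (\<sigma> \<circ> r) u sequentially"
      using MCauchy_converges_if_relatively_compact_levels[OF U rc sub r(2)] by blast
    moreover have "u \<in> U"
      using closed sub u unfolding metric_closedin_iff_sequentially_closed by blast
    ultimately show "\<exists>l r. l \<in> U \<and> strict_mono r \<and> limitin mtopology (\<sigma> \<circ> r) l sequentially"
      using r(1) by blast
  qed
qed

theorem theorem5p15: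
  fixes U :: "('a::metric_space \<Rightarrow> real) set"
  assumes "U \<subseteq> F_USCG"
  shows "(compactin (Metric_space.mtopology F_USCG H_end) U
            \<longleftrightarrow> (\<forall>\<alpha>\<in>{0<..1}. relatively_compact (level_union U \<alpha>)) \<and>
                closedin (Metric_space.mtopology F_USCG H_end) U)
       \<and> ((\<forall>\<alpha>\<in>{0<..1}. relatively_compact (level_union U \<alpha>)) \<and>
                closedin (Metric_space.mtopology F_USCG H_end) U
            \<longleftrightarrow> (\<forall>\<alpha>\<in>{0<..1}. compact (level_union U \<alpha>)) \<and>
                closedin (Metric_space.mtopology F_USCG H_end) U)"
proof -
  interpret Metric_space F_USCG "H_end :: ('a \<Rightarrow> real) \<Rightarrow> _" by (rule Metric_space_F_USCG)
  have "closedin mtopology U" if "compactin mtopology U"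
    using Hausdorff_space_mtopology that by (rule compactin_imp_closedin)
  moreover have "relatively_compact A" if "compact A" for A :: "'a set"
    using that by (simp add: relatively_compact_def compact_imp_closed)
  moreover note compact_level_union[of U] compactin_if_relatively_compact_levels[OF assms]
  ultimately show ?thesis by meson
qed

end
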